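(* Let $\mathbb{F}=\mathbb{C}$ or $\mathbb{F}=\mathbb{R}$. Let $L=\mathrm{span}\{X_1,\dots,X_n\}$ and $L'=\mathrm{span}\{Y_1,\dots,Y_n\}$ be two $n$-dimensional $\mathbb{F}$-Lie algebras with structure constants $a_{ij}^k\in\mathbb{F}$ and $b_{ij}^k\in\mathbb{F}$ with respect to the bases $\{X_i\}$ and $\{Y_i\}$, respectively. Consider the following system of polynomial equations in the $n^2+1$ unknowns $z$ and $z_{ij}$ ($1\le i,j\le n$): $$\begin{cases}\displaystyle\sum_{k=1}^n z_{ks}\,a_{ij}^k-\sum_{k,l=1}^n z_{ik}z_{jl}\,b_{kl}^s=0, & 1\le i<j\le n,\ s=1,\dots,n,\\[2mm] 1-z\det[\phi]=0,\end{cases}$$ where $[\phi]$ is the $n\times n$ matrix whose entry in row $j$ and column $i$ is $z_{ij}$. Then $L$ and $L'$ are isomorphic as $\mathbb{F}$-Lie algebras if and only if the zero set of this system in $\mathbb{F}^{n^2+1}$ is non-empty.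
   Context: An $\mathbb{F}$-Lie algebra is an $\mathbb{F}$-vector space with a skew-symmetric bilinear bracket satisfying the Jacobi identity. The structure constants of $L$ and $L'$ are defined by $[X_i,X_j]=\sum_{k=1}^n a_{ij}^kX_k$ and $[Y_i,Y_j]=\sum_{k=1}^n b_{ij}^kY_k$ for all $1\le i,j\le n$ (so they are skew-symmetric in $i,j$). An isomorphism $\phi:L\to L'$ is an $\mathbb{F}$-linear isomorphism with $\phi([X,Y]_L)=[\phi(X),\phi(Y)]_{L'}$ for all $X,Y\in L$. The matrix $[\phi]$ above corresponds to the linear map given by $\phi(X_i)=\sum_{k=1}^n z_{ik}Y_k$. *)

theory Defs
  imports "Jordan_Normal_Form.Determinant"
begin

locale lie_algebra = vector_space scale
  for scale :: "'f::field \<Rightarrow> 'v::ab_group_add \<Rightarrow> 'v" +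
  fixes bracket :: "'v \<Rightarrow> 'v \<Rightarrow> 'v"
  assumes bracket_linear_left: "Vector_Spaces.linear scale scale (\<lambda>x. bracket x y)"
    and bracket_linear_right: "Vector_Spaces.linear scale scale (\<lambda>y. bracket x y)"
    and bracket_skew: "bracket x y = - bracket y x"
    and jacobi: "bracket x (bracket y z) + bracket y (bracket z x) + bracket z (bracket x y) = 0"

text \<open>Indices run over \<open>0, \<dots>, n - 1\<close> instead of \<open>1, \<dots>, n\<close>, to match the indexing of
  matrices. The value \<open>a i j k\<close> is the structure constant with lower indices \<open>i, j\<close> and upper
  index \<open>k\<close>; values of \<open>X\<close> and \<open>a\<close> at indices that are not below \<open>n\<close> are irrelevant.\<close>

locale lie_algebra_with_basis = lie_algebra scale bracket
  for scale :: "'f::field \<Rightarrow> 'v::ab_group_add \<Rightarrow> 'v" and bracket :: "'v \<Rightarrow> 'v \<Rightarrow> 'v" +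
  fixes n :: nat and X :: "nat \<Rightarrow> 'v" and a :: "nat \<Rightarrow> nat \<Rightarrow> nat \<Rightarrow> 'f"
  assumes basis_inj: "inj_on X {..<n}"
    and basis_independent: "independent (X ` {..<n})"
    and basis_span: "span (X ` {..<n}) = UNIV"
    and structure_constants:
      "\<lbrakk>i < n; j < n\<rbrakk> \<Longrightarrow> bracket (X i) (X j) = (\<Sum>k<n. scale (a i j k) (X k))"

definition lie_isomorphism ::
  "('f::field \<Rightarrow> 'v::ab_group_add \<Rightarrow> 'v) \<Rightarrow> ('v \<Rightarrow> 'v \<Rightarrow> 'v) \<Rightarrow>
   ('f \<Rightarrow> 'w::ab_group_add \<Rightarrow> 'w) \<Rightarrow> ('w \<Rightarrow> 'w \<Rightarrow> 'w) \<Rightarrow> ('v \<Rightarrow> 'w) \<Rightarrow> bool" where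
  "lie_isomorphism scale bracket scale' bracket' \<phi> \<longleftrightarrow>
     Vector_Spaces.linear scale scale' \<phi> \<and> bij \<phi> \<and>
     (\<forall>x y. \<phi> (bracket x y) = bracket' (\<phi> x) (\<phi> y))"

definition lie_isomorphic ::
  "('f::field \<Rightarrow> 'v::ab_group_add \<Rightarrow> 'v) \<Rightarrow> ('v \<Rightarrow> 'v \<Rightarrow> 'v) \<Rightarrow>
   ('f \<Rightarrow> 'w::ab_group_add \<Rightarrow> 'w) \<Rightarrow> ('w \<Rightarrow> 'w \<Rightarrow> 'w) \<Rightarrow> bool" where
  "lie_isomorphic scale bracket scale' bracket' \<longleftrightarrow>
     (\<exists>\<phi>. lie_isomorphism scale bracket scale' bracket' \<phi>)"

text \<open>A point of the affine space of dimension \<open>n\<^sup>2 + 1\<close> is given as a pair \<open>(z, Z)\<close>, where the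
  \<open>n \<times> n\<close> matrix \<open>Z\<close> collects the unknowns \<open>z\<^sub>i\<^sub>j = Z $$ (i, j)\<close>. The matrix of \<open>\<phi>\<close> has \<open>z\<^sub>i\<^sub>j\<close> in
  row \<open>j\<close> and column \<open>i\<close>, so it is the transpose of \<open>Z\<close>.\<close>

definition iso_zero_set ::
  "nat \<Rightarrow> (nat \<Rightarrow> nat \<Rightarrow> nat \<Rightarrow> 'f::field) \<Rightarrow> (nat \<Rightarrow> nat \<Rightarrow> nat \<Rightarrow> 'f) \<Rightarrow> ('f \<times> 'f mat) set" where
  "iso_zero_set n a b = {(z, Z). Z \<in> carrier_mat n n \<and>
     (\<forall>i j s. i < j \<and> j < n \<and> s < n \<longrightarrow>
        (\<Sum>k<n. Z $$ (k, s) * a i j k) - (\<Sum>k<n. \<Sum>l<n. Z $$ (i, k) * Z $$ (j, l) * b k l s) = 0) \<and>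
     1 - z * det (transpose_mat Z) = 0}"

end

theory Submission imports Defs begin

text \<open>A linear map is determined by its values on a basis, so linear maps \<open>L \<rightarrow> L'\<close> correspond to
  matrices \<open>Z\<close>, with bijections corresponding to invertible ones. Comparing coordinates of
  \<open>\<phi> [X\<^sub>i, X\<^sub>j]\<close> and \<open>[\<phi> X\<^sub>i, \<phi> X\<^sub>j]\<close> turns compatibility with the brackets on basis vectors into the
  quadratic equations; by skew-symmetry the pairs \<open>i < j\<close> suffice, since the characteristic is
  not 2.\<close>

section \<open>Coordinates with respect to an indexed finite basis\<close>

locale indexed_basis = vector_space scale
  for scale :: "'f::field \<Rightarrow> 'v::ab_group_add \<Rightarrow> 'v" +
  fixes n :: nat and X :: "nat \<Rightarrow> 'v"
  assumes inj_basis: "inj_on X {..<n}"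
    and independent_basis: "independent (X ` {..<n})"
    and span_basis: "span (X ` {..<n}) = UNIV"
begin

lemma coordinates_exist: "\<exists>c. v = (\<Sum>k<n. scale (c k) (X k))"
proof -
  have "v \<in> span (X ` {..<n})"
    unfolding span_basis by simp
  then obtain u where "v = (\<Sum>w\<in>X ` {..<n}. scale (u w) w)"
    by (auto simp: span_finite)
  then have "v = (\<Sum>k<n. scale (u (X k)) (X k))"
    by (simp add: sum.reindex[OF inj_basis])
  then show ?thesis
    by (intro exI[of _ "\<lambda>k. u (X k)"])
qed

lemma coordinates_unique:
  assumes "(\<Sum>k<n. scale (c k) (X k)) = (\<Sum>k<n. scale (d k) (X k))" and "k < n"
  shows "c k = d k"
proof -
  \<comment> \<open>Independence is stated for coefficients attached to vectors; injectivity of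
    \<open>X\<close> lets \<open>?i\<close> turn each basis vector back into its index.\<close>
  let ?i = "the_inv_into {..<n} X"
  have "(\<Sum>w\<in>X ` {..<n}. scale (c (?i w) - d (?i w)) w) = (\<Sum>k<n. scale (c k - d k) (X k))"
    by (simp add: sum.reindex[OF inj_basis] the_inv_into_f_f[OF inj_basis])
  also have "\<dots> = 0"
    using assms(1) by (simp add: scale_left_diff_distrib sum_subtractf)
  finally have "c (?i (X k)) - d (?i (X k)) = 0"
    using independentD[OF independent_basis, of "X ` {..<n}" "\<lambda>w. c (?i w) - d (?i w)" "X k"]
      assms(2) by auto
  then show ?thesis
    using assms(2) by (simp add: the_inv_into_f_f[OF inj_basis])
qed

end

section \<open>Linear maps in coordinates: matrices, composition, invertibility\<close>

lemma linear_sum_scale: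
  assumes "Vector_Spaces.linear s t f"
  shows "f (\<Sum>k\<in>A. s (c k) (x k)) = (\<Sum>k\<in>A. t (c k) (f (x k)))"
proof -
  interpret f: Vector_Spaces.linear s t f by fact
  show ?thesis by (simp add: f.sum f.scale)
qed

lemma linear_inv:
  assumes "Vector_Spaces.linear s t f" and "bij f"
  shows "Vector_Spaces.linear t s (inv_into UNIV f)"
proof -
  interpret f: Vector_Spaces.linear s t f by fact
  \<comment> \<open>Reduces each law for the inverse to the equation obtained by applying
    \<open>f\<close>, where linearity of \<open>f\<close> settles it.\<close>
  have inv_eq: "inv_into UNIV f y = x \<longleftrightarrow> y = f x" for x y
    using assms(2) by (metis bij_inv_eq_iff)
  show ?thesis
    by unfold_locales
      (simp_all add: inv_eq f.add f.scale surj_f_inv_f[OF bij_is_surj[OF assms(2)]])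
qed

text \<open>No brackets occur here, so that the results can be reused with the two sides exchanged
  (\<open>swap\<close>) and with one basis on both sides (\<open>self\<close>).\<close>

locale indexed_basis_pair =
  V: indexed_basis scale n X + W: indexed_basis scale' n Y
  for scale :: "'f::field \<Rightarrow> 'v::ab_group_add \<Rightarrow> 'v" and n :: nat and X
    and scale' :: "'f::field \<Rightarrow> 'w::ab_group_add \<Rightarrow> 'w" and Y
begin

sublocale vector_space_pair scale scale' ..

lemma linear_ext:
  assumes "Vector_Spaces.linear scale scale' f" "Vector_Spaces.linear scale scale' g"
    and "\<And>i. i < n \<Longrightarrow> f (X i) = g (X i)"
  shows "f = g"
proof
  fix v
  show "f v = g v"
    using linear_eq_on_span[OF assms(1,2), of "X ` {..<n}" v] assms(3) V.span_basis by auto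
qed

text \<open>Row \<open>i\<close> of \<open>Z\<close> holds the coordinates of the image of
  \<open>X i\<close>, as in \<open>iso_zero_set\<close>; this is the transpose of the usual matrix
  of a linear map.\<close>

lemma matrix_of_linear:
  "\<exists>Z\<in>carrier_mat n n. \<forall>i<n. f (X i) = (\<Sum>k<n. scale' (Z $$ (i, k)) (Y k))"
proof -
  have "\<forall>i. \<exists>c. f (X i) = (\<Sum>k<n. scale' (c k) (Y k))"
    using W.coordinates_exist by blast
  then obtain c where "\<And>i. f (X i) = (\<Sum>k<n. scale' (c i k) (Y k))"
    unfolding choice_iff by blast
  then show ?thesis
    by (intro bexI[of _ "mat n n (\<lambda>(i, k). c i k)"]) auto
qed

text \<open>Values on an independent set can be prescribed freely and extended linearly; the rows of
  \<open>Z\<close> prescribe them.\<close>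

lemma linear_of_matrix:
  "\<exists>f. Vector_Spaces.linear scale scale' f \<and>
    (\<forall>i<n. f (X i) = (\<Sum>k<n. scale' (Z $$ (i, k)) (Y k)))"
proof -
  obtain f where "Vector_Spaces.linear scale scale' f" and "\<forall>x\<in>X ` {..<n}.
      f x = (\<Sum>k<n. scale' (Z $$ (the_inv_into {..<n} X x, k)) (Y k))"
    using linear_independent_extend[OF V.independent_basis,
        of "\<lambda>x. \<Sum>k<n. scale' (Z $$ (the_inv_into {..<n} X x, k)) (Y k)"] by blast
  then show ?thesis
    by (intro exI[of _ f]) (auto simp: the_inv_into_f_f[OF V.inj_basis])
qed

text \<open>With images stored in rows, products follow the order of application: first
  \<open>f\<close>, then \<open>g\<close> gives \<open>Z * W\<close>.\<close>

lemma matrix_of_composition: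
  assumes "Vector_Spaces.linear scale scale' f" "Vector_Spaces.linear scale' scale g"
    and Z: "Z \<in> carrier_mat n n" "\<forall>i<n. f (X i) = (\<Sum>k<n. scale' (Z $$ (i, k)) (Y k))"
    and W: "W \<in> carrier_mat n n" "\<forall>i<n. g (Y i) = (\<Sum>k<n. scale (W $$ (i, k)) (X k))"
    and "i < n"
  shows "g (f (X i)) = (\<Sum>l<n. scale ((Z * W) $$ (i, l)) (X l))"
proof -
  have "g (f (X i)) = (\<Sum>k<n. \<Sum>l<n. scale (Z $$ (i, k) * W $$ (k, l)) (X l))"
    using Z W \<open>i < n\<close> by (simp add: linear_sum_scale[OF assms(2)] V.scale_sum_right)
  also have "\<dots> = (\<Sum>l<n. scale (\<Sum>k<n. Z $$ (i, k) * W $$ (k, l)) (X l))"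
    by (subst sum.swap) (simp add: V.scale_sum_left)
  also have "\<dots> = (\<Sum>l<n. scale ((Z * W) $$ (i, l)) (X l))"
    using Z(1) W(1) \<open>i < n\<close> by (simp add: scalar_prod_def atLeast0LessThan)
  finally show ?thesis .
qed

lemma swap: "indexed_basis_pair scale' n Y scale X" ..

lemma self: "indexed_basis_pair scale n X scale X" ..

lemma left_inverse_iff_matrix:
  assumes "Vector_Spaces.linear scale scale' f" "Vector_Spaces.linear scale' scale g"
    and Z: "Z \<in> carrier_mat n n" "\<forall>i<n. f (X i) = (\<Sum>k<n. scale' (Z $$ (i, k)) (Y k))"
    and W: "W \<in> carrier_mat n n" "\<forall>i<n. g (Y i) = (\<Sum>k<n. scale (W $$ (i, k)) (X k))"
  shows "(\<forall>v. g (f v) = v) \<longleftrightarrow> Z * W = 1\<^sub>m n"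
proof
  note comp = matrix_of_composition[OF assms]
  have unit: "(\<Sum>l<n. scale (1\<^sub>m n $$ (i, l)) (X l)) = X i" if "i < n" for i
  proof -
    have "(\<Sum>l<n. scale (1\<^sub>m n $$ (i, l)) (X l)) = (\<Sum>l<n. if i = l then X l else 0)"
      using that by (intro sum.cong) auto
    then show ?thesis using that by simp
  qed
  {
    assume "\<forall>v. g (f v) = v"
    then have "(Z * W) $$ (i, l) = 1\<^sub>m n $$ (i, l)" if "i < n" "l < n" for i l
      using V.coordinates_unique[of "\<lambda>l. (Z * W) $$ (i, l)" "\<lambda>l. 1\<^sub>m n $$ (i, l)" l]
        comp[of i] unit[of i] that by simp
    then show "Z * W = 1\<^sub>m n"
      using Z(1) W(1) by (intro eq_matI) auto
  }
  assume "Z * W = 1\<^sub>m n"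
  then have "g (f (X i)) = X i" if "i < n" for i
    using comp[OF that] unit[OF that] by simp
  moreover have "Vector_Spaces.linear scale scale (g \<circ> f)"
    using assms(1,2) by (rule Vector_Spaces.linear_compose)
  \<comment> \<open>Both maps are endomorphisms of the first space, hence the instance with the same
    basis on both sides.\<close>
  ultimately have "g \<circ> f = id"
    using indexed_basis_pair.linear_ext[OF self, of "g \<circ> f" id] V.linear_id by simp
  then show "\<forall>v. g (f v) = v"
    by (simp add: fun_eq_iff)
qed

text \<open>The matrix of the inverse map inverts \<open>Z\<close>; conversely, a matrix inverse of
  \<open>Z\<close> defines an inverse map.\<close>

lemma bij_iff_det:
  assumes "Vector_Spaces.linear scale scale' f" and Z: "Z \<in> carrier_mat n n"
    "\<forall>i<n. f (X i) = (\<Sum>k<n. scale' (Z $$ (i, k)) (Y k))"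
  shows "bij f \<longleftrightarrow> det Z \<noteq> 0"
proof
  interpret swapped: indexed_basis_pair scale' n Y scale X by (rule swap)
  {
    assume "bij f"
    have g: "Vector_Spaces.linear scale' scale (inv_into UNIV f)"
      using assms(1) \<open>bij f\<close> by (rule linear_inv)
    obtain W where W: "W \<in> carrier_mat n n"
        "\<forall>i<n. inv_into UNIV f (Y i) = (\<Sum>k<n. scale (W $$ (i, k)) (X k))"
      using swapped.matrix_of_linear[of "inv_into UNIV f"] by blast
    have "Z * W = 1\<^sub>m n"
      using left_inverse_iff_matrix[OF assms(1) g Z W] \<open>bij f\<close> by (simp add: bij_is_inj)
    then have "det Z * det W = 1"
      using det_mult[OF Z(1) W(1)] by simp
    then show "det Z \<noteq> 0" by auto
  }
  assume "det Z \<noteq> 0"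
  \<comment> \<open>Each of the two products yields one of the two compositions, the second through
    the exchanged instance.\<close>
  then obtain W where W: "W \<in> carrier_mat n n" "Z * W = 1\<^sub>m n" "W * Z = 1\<^sub>m n"
    using det_non_zero_imp_unit[OF Z(1)] by (auto simp: Units_def ring_mat_def)
  obtain g where g: "Vector_Spaces.linear scale' scale g"
    "\<forall>i<n. g (Y i) = (\<Sum>k<n. scale (W $$ (i, k)) (X k))"
    using swapped.linear_of_matrix[of W] by blast
  have "\<forall>v. g (f v) = v"
    using left_inverse_iff_matrix[OF assms(1) g(1) Z W(1) g(2)] W(2) by simp
  moreover have "\<forall>w. f (g w) = w"
    using swapped.left_inverse_iff_matrix[OF g(1) assms(1) W(1) g(2) Z] W(3) by simp
  ultimately show "bij f"
    by (intro o_bij[of g]) (auto simp: fun_eq_iff)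
qed

end

section \<open>Bracket compatibility as polynomial equations\<close>

sublocale lie_algebra_with_basis \<subseteq> indexed_basis scale n X
  by unfold_locales (rule basis_inj basis_independent basis_span)+

text \<open>Skew-symmetry directly gives only \<open>2 [x, x] = 0\<close>, and the factor 2 must be
  cancelled. This serves the diagonal case \<open>i = j\<close>, for which the system has no
  equation.\<close>

lemma (in lie_algebra) bracket_self:
  assumes "(2 :: 'f) \<noteq> 0"
  shows "bracket x x = 0"
proof -
  have "scale 2 (bracket x x) = bracket x x + bracket x x"
    using scale_left_distrib[of 1 1 "bracket x x"] by simp
  also have "\<dots> = 0"
    using bracket_skew[of x x] by (metis add.left_inverse)
  finally show ?thesis
    using assms by simp
qed

text \<open>The class \<open>field_char_0\<close> covers the real and the complex case at once and
  makes 2 invertible.\<close>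

locale lie_algebra_pair =
  L: lie_algebra_with_basis scale bracket n X a + L': lie_algebra_with_basis scale' bracket' n Y b
  for scale :: "'f::field_char_0 \<Rightarrow> 'v::ab_group_add \<Rightarrow> 'v" and bracket n X a
    and scale' :: "'f \<Rightarrow> 'w::ab_group_add \<Rightarrow> 'w" and bracket' Y b
begin

sublocale indexed_basis_pair scale n X scale' Y ..

text \<open>Both sides are bilinear in \<open>x\<close> and \<open>y\<close>, so agreement spreads
  from basis vectors one argument at a time.\<close>

lemma bracket_hom_iff_basis:
  assumes "Vector_Spaces.linear scale scale' f"
  shows "(\<forall>x y. f (bracket x y) = bracket' (f x) (f y)) \<longleftrightarrow>
    (\<forall>i<n. \<forall>j<n. f (bracket (X i) (X j)) = bracket' (f (X i)) (f (X j)))"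
proof (intro iffI allI)
  fix x y
  assume *: "\<forall>i<n. \<forall>j<n. f (bracket (X i) (X j)) = bracket' (f (X i)) (f (X j))"
  have left: "Vector_Spaces.linear scale scale' (\<lambda>x. f (bracket x y))"
    "Vector_Spaces.linear scale scale' (\<lambda>x. bracket' (f x) (f y))" for y
    using Vector_Spaces.linear_compose[OF L.bracket_linear_left assms]
      Vector_Spaces.linear_compose[OF assms L'.bracket_linear_left]
    by (simp_all add: o_def)
  have right: "Vector_Spaces.linear scale scale' (\<lambda>y. f (bracket x y))"
    "Vector_Spaces.linear scale scale' (\<lambda>y. bracket' (f x) (f y))" for x
    using Vector_Spaces.linear_compose[OF L.bracket_linear_right assms]
      Vector_Spaces.linear_compose[OF assms L'.bracket_linear_right]
    by (simp_all add: o_def)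
  \<comment> \<open>The first argument becomes arbitrary while the second stays a basis vector; the
    second is freed afterwards.\<close>
  have "f (bracket x (X j)) = bracket' (f x) (f (X j))" if "j < n" for j
    using linear_ext[OF left[of "X j"]] * that by (simp add: fun_eq_iff)
  then show "f (bracket x y) = bracket' (f x) (f y)"
    using linear_ext[OF right[of x]] by (simp add: fun_eq_iff)
qed simp

text \<open>Exchanging \<open>i\<close> and \<open>j\<close> negates both sides, and for
  \<open>i = j\<close> both vanish.\<close>

lemma bracket_hom_basis_iff_less:
  assumes "Vector_Spaces.linear scale scale' f"
  shows "(\<forall>i<n. \<forall>j<n. f (bracket (X i) (X j)) = bracket' (f (X i)) (f (X j))) \<longleftrightarrow>
    (\<forall>i j. i < j \<and> j < n \<longrightarrow> f (bracket (X i) (X j)) = bracket' (f (X i)) (f (X j)))"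
proof (intro iffI allI impI)
  interpret f: Vector_Spaces.linear scale scale' f by fact
  fix i j
  assume *: "\<forall>i j. i < j \<and> j < n \<longrightarrow> f (bracket (X i) (X j)) = bracket' (f (X i)) (f (X j))"
    and "i < n" "j < n"
  consider "i < j" | "i = j" | "j < i" by linarith
  then show "f (bracket (X i) (X j)) = bracket' (f (X i)) (f (X j))"
  proof cases
    case 3
    then show ?thesis
      using * \<open>i < n\<close> L.bracket_skew[of "X i" "X j"] L'.bracket_skew[of "f (X i)" "f (X j)"]
      by (simp add: f.neg)
  qed (use * \<open>j < n\<close> in \<open>auto simp: L.bracket_self L'.bracket_self\<close>)
qed auto

lemma bracket_hom_basis_iff_equations:
  assumes "Vector_Spaces.linear scale scale' f"
    and f: "\<forall>i<n. f (X i) = (\<Sum>k<n. scale' (Z $$ (i, k)) (Y k))"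
    and ij: "i < n" "j < n"
  shows "f (bracket (X i) (X j)) = bracket' (f (X i)) (f (X j)) \<longleftrightarrow>
    (\<forall>s<n. (\<Sum>k<n. Z $$ (k, s) * a i j k) -
        (\<Sum>k<n. \<Sum>l<n. Z $$ (i, k) * Z $$ (j, l) * b k l s) = 0)"
proof -
  \<comment> \<open>\<open>?p s\<close> and \<open>?q s\<close> will be the coordinates at
    \<open>Y s\<close> of the image of the bracket and of the bracket of the images.\<close>
  let ?p = "\<lambda>s. \<Sum>k<n. Z $$ (k, s) * a i j k"
  let ?q = "\<lambda>s. \<Sum>k<n. \<Sum>l<n. Z $$ (i, k) * Z $$ (j, l) * b k l s"
  have "f (bracket (X i) (X j)) = (\<Sum>k<n. \<Sum>s<n. scale' (Z $$ (k, s) * a i j k) (Y s))"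
    using L.structure_constants[OF ij]
    by (simp add: linear_sum_scale[OF assms(1)] f L'.scale_sum_right mult.commute)
  also have "\<dots> = (\<Sum>s<n. scale' (?p s) (Y s))"
    by (subst sum.swap) (simp add: L'.scale_sum_left)
  finally have lhs: "f (bracket (X i) (X j)) = \<dots>" .
  have "bracket' (f (X i)) (f (X j)) =
      (\<Sum>k<n. scale' (Z $$ (i, k)) (bracket' (Y k) (f (X j))))"
    using ij by (simp add: f linear_sum_scale[OF L'.bracket_linear_left])
  also have "\<dots> = (\<Sum>k<n. \<Sum>l<n. \<Sum>s<n. scale' (Z $$ (i, k) * Z $$ (j, l) * b k l s) (Y s))"
    using ij by (simp add: f linear_sum_scale[OF L'.bracket_linear_right] L'.structure_constants
      L'.scale_sum_right mult.assoc)
  \<comment> \<open>The basis index \<open>s\<close> moves outwards, past \<open>l\<close> here and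
    past \<open>k\<close> in the next step.\<close>
  also have "\<dots> = (\<Sum>k<n. \<Sum>s<n. \<Sum>l<n. scale' (Z $$ (i, k) * Z $$ (j, l) * b k l s) (Y s))"
    by (intro sum.cong refl sum.swap)
  also have "\<dots> = (\<Sum>s<n. scale' (?q s) (Y s))"
    by (subst sum.swap) (simp add: L'.scale_sum_left)
  finally have rhs: "bracket' (f (X i)) (f (X j)) = \<dots>" .
  have "(\<Sum>s<n. scale' (?p s) (Y s)) = (\<Sum>s<n. scale' (?q s) (Y s)) \<longleftrightarrow> (\<forall>s<n. ?p s = ?q s)"
    using L'.coordinates_unique[of ?p ?q] by auto
  then show ?thesis
    by (simp add: lhs rhs)
qed

section \<open>Isomorphisms and points of the zero set\<close>

lemma lie_isomorphism_iff_equations: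
  assumes "Vector_Spaces.linear scale scale' f" and Z: "Z \<in> carrier_mat n n"
    "\<forall>i<n. f (X i) = (\<Sum>k<n. scale' (Z $$ (i, k)) (Y k))"
  shows "lie_isomorphism scale bracket scale' bracket' f \<longleftrightarrow> (\<exists>z. (z, Z) \<in> iso_zero_set n a b)"
proof -
  \<comment> \<open>The extra unknown expresses invertibility as an equation (Rabinowitsch trick):
    \<open>z\<close> has to be the inverse of the determinant, which transposition
    preserves.\<close>
  have "(\<exists>z. 1 - z * det (transpose_mat Z) = 0) \<longleftrightarrow> det Z \<noteq> 0"
    by (auto simp: det_transpose[OF Z(1)] intro: exI[of _ "inverse (det Z)"])
  moreover have "(\<forall>x y. f (bracket x y) = bracket' (f x) (f y)) \<longleftrightarrow>
    (\<forall>i j s. i < j \<and> j < n \<and> s < n \<longrightarrow>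
      (\<Sum>k<n. Z $$ (k, s) * a i j k) -
        (\<Sum>k<n. \<Sum>l<n. Z $$ (i, k) * Z $$ (j, l) * b k l s) = 0)"
    unfolding bracket_hom_iff_basis[OF assms(1)] bracket_hom_basis_iff_less[OF assms(1)]
    using bracket_hom_basis_iff_equations[OF assms(1) Z(2)] by (meson less_trans)
  ultimately show ?thesis
    using assms(1) Z(1) bij_iff_det[OF assms(1) Z]
    by (simp add: lie_isomorphism_def iso_zero_set_def conj_commute)
qed

lemma lie_isomorphic_iff_zero_set:
  "lie_isomorphic scale bracket scale' bracket' \<longleftrightarrow> iso_zero_set n a b \<noteq> {}"
proof
  assume "lie_isomorphic scale bracket scale' bracket'"
  then obtain f where f: "lie_isomorphism scale bracket scale' bracket' f"
    "Vector_Spaces.linear scale scale' f"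
    by (auto simp: lie_isomorphic_def lie_isomorphism_def)
  obtain Z where "Z \<in> carrier_mat n n"
    "\<forall>i<n. f (X i) = (\<Sum>k<n. scale' (Z $$ (i, k)) (Y k))"
    using matrix_of_linear[of f] by blast
  then show "iso_zero_set n a b \<noteq> {}"
    using lie_isomorphism_iff_equations[OF f(2)] f(1) by blast
next
  assume "iso_zero_set n a b \<noteq> {}"
  then obtain z Z where zZ: "(z, Z) \<in> iso_zero_set n a b" by auto
  then have "Z \<in> carrier_mat n n" by (simp add: iso_zero_set_def)
  moreover obtain f where "Vector_Spaces.linear scale scale' f"
    "\<forall>i<n. f (X i) = (\<Sum>k<n. scale' (Z $$ (i, k)) (Y k))"
    using linear_of_matrix[of Z] by blast
  ultimately show "lie_isomorphic scale bracket scale' bracket'"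
    using lie_isomorphism_iff_equations zZ unfolding lie_isomorphic_def by blast
qed

end

theorem theorem5p1:
  fixes n :: nat
  shows
    "(\<forall>(scale :: real \<Rightarrow> 'v::ab_group_add \<Rightarrow> 'v) bracket X a
       (scale' :: real \<Rightarrow> 'w::ab_group_add \<Rightarrow> 'w) bracket' Y b.
        lie_algebra_with_basis scale bracket n X a \<and>
        lie_algebra_with_basis scale' bracket' n Y b \<longrightarrow>
        (lie_isomorphic scale bracket scale' bracket' \<longleftrightarrow> iso_zero_set n a b \<noteq> {})) \<and>
     (\<forall>(scale :: complex \<Rightarrow> 'v \<Rightarrow> 'v) bracket X a
       (scale' :: complex \<Rightarrow> 'w \<Rightarrow> 'w) bracket' Y b.
        lie_algebra_with_basis scale bracket n X a \<and>
        lie_algebra_with_basis scale' bracket' n Y b \<longrightarrow>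
        (lie_isomorphic scale bracket scale' bracket' \<longleftrightarrow> iso_zero_set n a b \<noteq> {}))"
  \<comment> \<open>Both conjuncts are instances of the equivalence over fields of characteristic
    0.\<close>
  by (intro conjI allI impI lie_algebra_pair.lie_isomorphic_iff_zero_set lie_algebra_pair.intro) auto

end
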